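(* Let $A$ be a finite set with $k$ elements $(k\ge 3)$. If $\lambda_T$ is an $h$-regular relation on $A$ such that $h<k$, then $\mathrm{Pol}\,\lambda_T\notin\mathfrak{F}_A$.
   Context: For $n\ge 1$, an $n$-ary operation on $A$ is a function $A^n\to A$; $\mathcal{O}_A$ is the set of all finitary operations on $A$, and $\mathcal{C}^{(n)}$ is the set of $n$-ary members of $\mathcal{C}\subseteq\mathcal{O}_A$. A clone on $A$ is a set $\mathcal{C}\subseteq\mathcal{O}_A$ containing all projections and closed under composition. For a clone $\mathcal{C}$, an $n$-ary $f$ and an $m$-ary $g$ in $\mathcal{O}_A$, write $f\leq_{\mathcal{C}} g$ if $f=g(h_1,\dots,h_m)$ for some $h_1,\dots,h_m\in\mathcal{C}^{(n)}$, and $f\equiv_{\mathcal{C}}g$ if $f\leq_{\mathcal{C}}g$ and $g\leq_{\mathcal{C}}f$. $\mathfrak{F}_A$ denotes the set of all clones $\mathcal{C}$ on $A$ such that the equivalence relation $\equiv_{\mathcal{C}}$ on $\mathcal{O}_A$ has only finitely many classes. For an integer $h\geq 3$, a family $T=\{\theta_1,\dots,\theta_r\}$ ($r\ge1$) of equivalence relations on $A$ is $h$-regular if each $\theta_i$ has exactly $h$ blocks and for arbitrary blocks $B_i$ of $\theta_i$ ($1\le i\le r$) the intersection $\bigcap_{i=1}^r B_i$ is nonempty. The associated $h$-regular relation is $\lambda_T=\{(a_1,\dots,a_h)\in A^h:\text{ for each } i,\ a_1,\dots,a_h \text{ is not a transversal for the blocks of }\theta_i\}$. $\mathrm{Pol}\,\lambda_T$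 is the clone of all operations on $A$ which applied coordinatewise to tuples of $\lambda_T$ give tuples of $\lambda_T$. *)

theory Defs
  imports Main "HOL-Library.FuncSet" "HOL-Library.NList"
begin

section \<open>Finitary operations and clones on a carrier set\<close>

text \<open>
  Tuples are lists, so \<open>A\<^sup>n\<close> is \<^term>\<open>nlists n A\<close>. An operation is a pair of its arity
  and a function that is extensional on the tuples of that length; hence equality of such pairs
  is equality of operations.
\<close>

type_synonym 'a operation = "nat \<times> ('a list \<Rightarrow> 'a)"

definition operations :: "'a set \<Rightarrow> 'a operation set" where
  "operations A = (SIGMA n:{1..}. nlists n A \<rightarrow>\<^sub>E A)"

definition nary_part :: "'a operation set \<Rightarrow> nat \<Rightarrow> ('a list \<Rightarrow> 'a) set" where
  "nary_part C n = {f. (n, f) \<in> C}"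

definition projection :: "'a set \<Rightarrow> nat \<Rightarrow> nat \<Rightarrow> 'a list \<Rightarrow> 'a" where
  "projection A n i = (\<lambda>xs\<in>nlists n A. xs ! i)"

definition compose_op ::
  "'a set \<Rightarrow> nat \<Rightarrow> ('a list \<Rightarrow> 'a) \<Rightarrow> ('a list \<Rightarrow> 'a) list \<Rightarrow> 'a list \<Rightarrow> 'a" where
  "compose_op A n g hs = (\<lambda>xs\<in>nlists n A. g (map (\<lambda>h. h xs) hs))"

definition clone :: "'a set \<Rightarrow> 'a operation set \<Rightarrow> bool" where
  "clone A C \<longleftrightarrow>
     C \<subseteq> operations A \<and>
     (\<forall>n\<ge>1. \<forall>i<n. projection A n i \<in> nary_part C n) \<and>
     (\<forall>m\<ge>1. \<forall>n\<ge>1. \<forall>g\<in>nary_part C m. \<forall>hs\<in>nlists m (nary_part C n).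
        compose_op A n g hs \<in> nary_part C n)"

definition clone_le :: "'a set \<Rightarrow> 'a operation set \<Rightarrow> 'a operation \<Rightarrow> 'a operation \<Rightarrow> bool" where
  "clone_le A C F G \<longleftrightarrow>
     (\<exists>hs\<in>nlists (fst G) (nary_part C (fst F)). snd F = compose_op A (fst F) (snd G) hs)"

definition clone_equiv :: "'a set \<Rightarrow> 'a operation set \<Rightarrow> 'a operation rel" where
  "clone_equiv A C =
     {(F, G). F \<in> operations A \<and> G \<in> operations A \<and> clone_le A C F G \<and> clone_le A C G F}"

text \<open>The set \<open>\<FF>\<^sub>A\<close>.\<close>

definition finite_equiv_clones :: "'a set \<Rightarrow> 'a operation set set" where
  "finite_equiv_clones A = {C. clone A C \<and> finite (operations A // clone_equiv A C)}"

section \<open>Polymorphisms and regular relations\<close>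

text \<open>\<open>R\<close> is an \<open>h\<close>-ary relation, that is, a set of lists of length \<open>h\<close>.\<close>

definition preserves :: "nat \<Rightarrow> ('a list \<Rightarrow> 'a) \<Rightarrow> nat \<Rightarrow> 'a list set \<Rightarrow> bool" where
  "preserves n f h R \<longleftrightarrow>
     (\<forall>rs\<in>nlists n R. map (\<lambda>j. f (map (\<lambda>r. r ! j) rs)) [0..<h] \<in> R)"

definition Pol :: "'a set \<Rightarrow> nat \<Rightarrow> 'a list set \<Rightarrow> 'a operation set" where
  "Pol A h R = {(n, f). (n, f) \<in> operations A \<and> preserves n f h R}"

text \<open>
  The blocks \<open>B\<^sub>i\<close>, one for each member of the family, are given by a choice function \<open>B\<close>
  on \<open>T\<close>. Since \<open>h \<ge> 3\<close>, repeating a member of the family would violate the intersection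
  condition, so the family is a set.
\<close>

definition regular_family :: "'a set \<Rightarrow> nat \<Rightarrow> 'a rel set \<Rightarrow> bool" where
  "regular_family A h T \<longleftrightarrow>
     3 \<le> h \<and> finite T \<and> T \<noteq> {} \<and>
     (\<forall>\<theta>\<in>T. equiv A \<theta> \<and> card (A // \<theta>) = h) \<and>
     (\<forall>B. (\<forall>\<theta>\<in>T. B \<theta> \<in> A // \<theta>) \<longrightarrow> (\<Inter>\<theta>\<in>T. B \<theta>) \<noteq> {})"

definition transversal :: "'a list \<Rightarrow> 'a set set \<Rightarrow> bool" where
  "transversal as P \<longleftrightarrow> set as \<subseteq> \<Union> P \<and> (\<forall>B\<in>P. \<exists>!i. i < length as \<and> as ! i \<in> B)"

definition regular_relation :: "'a set \<Rightarrow> nat \<Rightarrow> 'a rel set \<Rightarrow> 'a list set" where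
  "regular_relation A h T = {as \<in> nlists h A. \<forall>\<theta>\<in>T. \<not> transversal as (A // \<theta>)}"

section \<open>Well-definedness\<close>

lemma compose_op_assoc:
  assumes "\<And>h. h \<in> set hs \<Longrightarrow> h \<in> nlists m A \<rightarrow>\<^sub>E A"
    and "\<And>k. k \<in> set ks \<Longrightarrow> k \<in> nlists n A \<rightarrow>\<^sub>E A" and "length ks = m"
  shows "compose_op A n (compose_op A m g hs) ks
       = compose_op A n g (map (\<lambda>h. compose_op A n h ks) hs)"
proof
  fix xs
  show "compose_op A n (compose_op A m g hs) ks xs
      = compose_op A n g (map (\<lambda>h. compose_op A n h ks) hs) xs"
  proof (cases "xs \<in> nlists n A")
    case True
    then have "map (\<lambda>k. k xs) ks \<in> nlists m A"
      using assms(2,3) by (intro nlistsI) (auto dest!: PiE_mem)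
    with True show ?thesis
      by (simp add: compose_op_def comp_def)
  qed (simp add: compose_op_def)
qed

lemma compose_op_projections:
  assumes "f \<in> nlists n A \<rightarrow>\<^sub>E A"
  shows "compose_op A n f (map (projection A n) [0..<n]) = f"
proof
  fix xs
  show "compose_op A n f (map (projection A n) [0..<n]) xs = f xs"
  proof (cases "xs \<in> nlists n A")
    case True
    then have "map ((!) xs) [0..<n] = xs"
      by (metis map_nth nlistsE_length)
    with True show ?thesis
      by (simp add: compose_op_def projection_def comp_def)
  qed (use assms in \<open>auto simp: compose_op_def PiE_def extensional_def\<close>)
qed

lemma equiv_clone_equiv:
  assumes "clone A C"
  shows "equiv (operations A) (clone_equiv A C)"
proof -
  have part: "h \<in> nlists n A \<rightarrow>\<^sub>E A" "1 \<le> n" if "h \<in> nary_part C n" for h n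
    using that assms by (auto simp: clone_def nary_part_def operations_def)
  have refl: "clone_le A C F F" if "F \<in> operations A" for F
  proof -
    have F: "snd F \<in> nlists (fst F) A \<rightarrow>\<^sub>E A" "1 \<le> fst F"
      using that by (auto simp: operations_def)
    have "map (projection A (fst F)) [0..<fst F] \<in> nlists (fst F) (nary_part C (fst F))"
      using assms F(2) by (intro nlistsI) (auto simp: clone_def)
    then show ?thesis
      unfolding clone_le_def using compose_op_projections[OF F(1)] by metis
  qed
  have trans: "clone_le A C F H"
    if FG: "clone_le A C F G" and GH: "clone_le A C G H"
      and ops: "F \<in> operations A" "G \<in> operations A" for F G H
  proof -
    obtain ks where ks: "ks \<in> nlists (fst G) (nary_part C (fst F))"
        "snd F = compose_op A (fst F) (snd G) ks"
      using FG unfolding clone_le_def by blast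
    obtain hs where hs: "hs \<in> nlists (fst H) (nary_part C (fst G))"
        "snd G = compose_op A (fst G) (snd H) hs"
      using GH unfolding clone_le_def by blast
    let ?ls = "map (\<lambda>h. compose_op A (fst F) h ks) hs"
    have "1 \<le> fst F" "1 \<le> fst G"
      using ops by (auto simp: operations_def)
    then have "compose_op A (fst F) h ks \<in> nary_part C (fst F)" if "h \<in> set hs" for h
      using that assms ks(1) nlistsE_set[OF hs(1)] unfolding clone_def by blast
    then have "?ls \<in> nlists (fst H) (nary_part C (fst F))"
      using hs(1) by (intro nlistsI) auto
    moreover have "snd F = compose_op A (fst F) (snd H) ?ls"
      unfolding ks(2) hs(2)
      using part nlistsE_set[OF ks(1)] nlistsE_set[OF hs(1)] nlistsE_length[OF ks(1)]
      by (intro compose_op_assoc) blast+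
    ultimately show ?thesis
      unfolding clone_le_def by blast
  qed
  show ?thesis
  proof (rule equivI)
    show "trans (clone_equiv A C)"
      unfolding clone_equiv_def by (rule transI) (use trans in blast)
  qed (auto simp: clone_equiv_def refl_on_def sym_def refl)
qed

lemma clone_Pol:
  assumes R: "R \<subseteq> nlists h A"
  shows "clone A (Pol A h R)"
proof -
  have col: "map (\<lambda>r. r ! j) rs \<in> nlists n A" if "rs \<in> nlists n R" "j < h" for rs n j
  proof -
    have "r ! j \<in> A" if "r \<in> set rs" for r
      using that \<open>j < h\<close> R nlistsE_set[OF \<open>rs \<in> nlists n R\<close>] nlistsE_nth_in by (metis subsetD)
    then show ?thesis
      using nlistsE_length[OF \<open>rs \<in> nlists n R\<close>] by (intro nlistsI) auto
  qed
  have proj: "projection A n i \<in> nary_part (Pol A h R) n" if "1 \<le> n" "i < n" for n i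
  proof -
    have "map (\<lambda>j. projection A n i (map (\<lambda>r. r ! j) rs)) [0..<h] \<in> R"
      if rs: "rs \<in> nlists n R" for rs
    proof -
      have ri: "rs ! i \<in> R"
        using nlistsE_nth_in[OF rs \<open>i < n\<close>] .
      have "map (\<lambda>j. projection A n i (map (\<lambda>r. r ! j) rs)) [0..<h] = map ((!) (rs ! i)) [0..<h]"
        using col[OF rs] nlistsE_length[OF rs] \<open>i < n\<close> by (auto simp: projection_def)
      also have "\<dots> = rs ! i"
        using ri R by (metis map_nth nlistsE_length subsetD)
      finally show ?thesis using ri by simp
    qed
    then show ?thesis
      using that by (auto simp: nary_part_def Pol_def operations_def preserves_def projection_def
          intro!: nlistsE_nth_in)
  qed
  have comp: "compose_op A n g hs \<in> nary_part (Pol A h R) n"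
    if "1 \<le> n" and g: "g \<in> nary_part (Pol A h R) m"
      and hs: "hs \<in> nlists m (nary_part (Pol A h R) n)" for m n g hs
  proof -
    have hsP: "f \<in> nlists n A \<rightarrow>\<^sub>E A" "preserves n f h R" if "f \<in> set hs" for f
      using that nlistsE_set[OF hs] by (auto simp: nary_part_def Pol_def operations_def)
    have gP: "g \<in> nlists m A \<rightarrow>\<^sub>E A" "preserves m g h R"
      using g by (auto simp: nary_part_def Pol_def operations_def)
    have "map (\<lambda>f. f xs) hs \<in> nlists m A" if "xs \<in> nlists n A" for xs
      using that hsP nlistsE_length[OF hs] by (intro nlistsI) (auto dest!: PiE_mem)
    then have "compose_op A n g hs \<in> nlists n A \<rightarrow>\<^sub>E A"
      using gP(1) by (auto simp: compose_op_def)
    moreover have "preserves n (compose_op A n g hs) h R"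
      unfolding preserves_def
    proof
      fix rs assume rs: "rs \<in> nlists n R"
      define ss where "ss = map (\<lambda>f. map (\<lambda>j. f (map (\<lambda>r. r ! j) rs)) [0..<h]) hs"
      have "ss \<in> nlists m R"
        using hsP(2) rs nlistsE_length[OF hs] unfolding ss_def preserves_def
        by (intro nlistsI) auto
      then have "map (\<lambda>j. g (map (\<lambda>r. r ! j) ss)) [0..<h] \<in> R"
        using gP(2) unfolding preserves_def by blast
      also have "map (\<lambda>j. g (map (\<lambda>r. r ! j) ss)) [0..<h]
          = map (\<lambda>j. compose_op A n g hs (map (\<lambda>r. r ! j) rs)) [0..<h]"
        using col[OF rs] by (auto simp: ss_def compose_op_def comp_def)
      finally show "map (\<lambda>j. compose_op A n g hs (map (\<lambda>r. r ! j) rs)) [0..<h] \<in> R" .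
    qed
    ultimately show ?thesis
      using \<open>1 \<le> n\<close> by (auto simp: nary_part_def Pol_def operations_def)
  qed
  show ?thesis
    unfolding clone_def using proj comp by (auto simp: Pol_def)
qed

end

theory Submission
  imports Defs
begin

text \<open>
  Choose \<open>b\<^sub>0, \<dots>, b\<^sub>h\<^sub>-\<^sub>1\<close> in \<open>A\<close> that lie in different blocks of every member of \<open>T\<close>, and, as
  \<open>h < k\<close>, one further element \<open>z\<close>. Fix \<open>\<theta> \<in> T\<close> and let \<open>f\<^sub>n\<close> map a tuple to \<open>b\<^sub>v\<close> if all its
  entries are \<open>\<theta>\<close>-related to \<open>b\<^sub>v\<close>, and to \<open>z\<close> otherwise. If \<open>f\<^sub>n = f\<^sub>m(F\<^sub>1, \<dots>, F\<^sub>m)\<close> with all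
  \<open>F\<^sub>j\<close> in \<open>Pol \<lambda>\<^sub>T\<close>, then each \<open>F\<^sub>j\<close> maps the constant tuple of \<open>b\<^sub>v\<close> into the \<open>\<theta>\<close>-block of \<open>b\<^sub>v\<close>.
  A Slupecki-type argument shows that replacing a single entry of \<open>(b\<^sub>0, \<dots>, b\<^sub>0)\<close> by \<open>b\<^sub>1\<close> changes
  the \<open>\<theta>\<close>-block of \<open>F\<^sub>j\<close> for at most one position. It changes the value of \<open>f\<^sub>n\<close> for all \<open>n\<close>
  positions, so \<open>n \<le> m\<close>. Hence the \<open>f\<^sub>n\<close> are pairwise inequivalent.
\<close>

section \<open>A transversal shared by all members of the family\<close>

locale separated_family =
  fixes A :: "'a set" and h :: nat and T :: "'a rel set" and b :: "nat \<Rightarrow> 'a"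
  assumes three_le: "3 \<le> h"
    and equiv: "\<theta> \<in> T \<Longrightarrow> equiv A \<theta>"
    and base_in: "v < h \<Longrightarrow> b v \<in> A"
    and base_separated: "\<theta> \<in> T \<Longrightarrow> v < h \<Longrightarrow> w < h \<Longrightarrow> (b v, b w) \<in> \<theta> \<Longrightarrow> v = w"
    and base_covers: "\<theta> \<in> T \<Longrightarrow> a \<in> A \<Longrightarrow> \<exists>v<h. (a, b v) \<in> \<theta>"

text \<open>Number the blocks of each member by 0, ..., h - 1. Whatever the numberings, regularity
  makes the blocks with number \<open>v\<close> meet, and \<open>b v\<close> is taken from their
  intersection.\<close>

lemma regular_family_separated:
  assumes "regular_family A h T"
  obtains b where "separated_family A h T b"
proof -
  have h: "3 \<le> h" and eq: "\<And>\<theta>. \<theta> \<in> T \<Longrightarrow> equiv A \<theta>" and card: "\<And>\<theta>. \<theta> \<in> T \<Longrightarrow> card (A // \<theta>) = h"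
    and meet: "\<And>B. (\<forall>\<theta>\<in>T. B \<theta> \<in> A // \<theta>) \<Longrightarrow> (\<Inter>\<theta>\<in>T. B \<theta>) \<noteq> {}" and "T \<noteq> {}"
    using assms by (auto simp: regular_family_def)
  \<comment> \<open>The cardinality \<open>h\<close> is positive, so \<open>A // \<theta>\<close> is
    finite.\<close>
  have "\<exists>e. bij_betw e {0..<h} (A // \<theta>)" if "\<theta> \<in> T" for \<theta>
    using ex_bij_betw_nat_finite[of "A // \<theta>"] card[OF that] h card_ge_0_finite[of "A // \<theta>"] by force
  then obtain e where e: "\<And>\<theta>. \<theta> \<in> T \<Longrightarrow> bij_betw (e \<theta>) {0..<h} (A // \<theta>)"
    by metis
  have "\<exists>a. \<forall>\<theta>\<in>T. a \<in> e \<theta> v" if "v < h" for v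
    using meet[of "\<lambda>\<theta>. e \<theta> v"] e that by (fastforce simp: bij_betw_def)
  then obtain b where b: "\<And>v \<theta>. v < h \<Longrightarrow> \<theta> \<in> T \<Longrightarrow> b v \<in> e \<theta> v"
    by metis
  have block: "e \<theta> v \<in> A // \<theta>" if "\<theta> \<in> T" "v < h" for \<theta> v
    using bij_betw_apply[OF e[OF that(1)]] that(2) by simp
  have "separated_family A h T b"
  proof
    show "b v \<in> A" if "v < h" for v
      using that block b eq \<open>T \<noteq> {}\<close> by (meson all_not_in_conv in_quotient_imp_subset subsetD)
    show "v = w" if "\<theta> \<in> T" "v < h" "w < h" "(b v, b w) \<in> \<theta>" for \<theta> v w
    proof -
      have "e \<theta> v = e \<theta> w"
        using quotient_eqI[OF eq block block b b] that by blast
      then show ?thesis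
        using e[OF that(1)] that by (auto simp: bij_betw_def inj_on_def)
    qed
    show "\<exists>v<h. (a, b v) \<in> \<theta>" if "\<theta> \<in> T" "a \<in> A" for \<theta> a
    proof -
      have "\<theta> `` {a} \<in> e \<theta> ` {0..<h}"
        using e[OF that(1)] that by (auto simp: bij_betw_def intro: quotientI)
      then obtain v where "v < h" "\<theta> `` {a} = e \<theta> v"
        by auto
      then show ?thesis
        using b that by blast
    qed
  qed (use h eq in auto)
  then show thesis ..
qed

section \<open>Operations preserving the regular relation\<close>

context separated_family
begin

text \<open>Read \<open>X 0\<close>, ..., \<open>X (h - 1)\<close> as rows of a matrix. A column
  with a repeated entry is a transversal for no member of \<open>T\<close>, so all columns lie in
  the relation. Then so does the tuple of the values of \<open>F\<close> on the rows, although
  \<open>val\<close> makes it a transversal for \<theta>.\<close>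

lemma not_preserving:
  assumes F: "F \<in> nlists n A \<rightarrow>\<^sub>E A" and pres: "preserves n F h (regular_relation A h T)"
    and \<theta>: "\<theta> \<in> T" and X: "\<And>v. v < h \<Longrightarrow> X v \<in> nlists n A"
    and val: "\<And>v. v < h \<Longrightarrow> (F (X v), b v) \<in> \<theta>"
    and rep: "\<And>c. c < n \<Longrightarrow> \<exists>v<h. \<exists>w<h. v \<noteq> w \<and> X v ! c = X w ! c"
  shows False
proof -
  define rs where "rs = map (\<lambda>c. map (\<lambda>v. X v ! c) [0..<h]) [0..<n]"
  have col: "map (\<lambda>v. X v ! c) [0..<h] \<in> regular_relation A h T" if "c < n" for c
  proof -
    have "map (\<lambda>v. X v ! c) [0..<h] \<in> nlists h A"
      using nlistsE_nth_in[OF X that] by (intro nlistsI) auto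
    moreover have "\<not> transversal (map (\<lambda>v. X v ! c) [0..<h]) (A // \<theta>')" if "\<theta>' \<in> T" for \<theta>'
    proof
      assume tr: "transversal (map (\<lambda>v. X v ! c) [0..<h]) (A // \<theta>')"
      obtain v w where vw: "v < h" "w < h" "v \<noteq> w" "X v ! c = X w ! c"
        using rep \<open>c < n\<close> by blast
      have "X v ! c \<in> set (map (\<lambda>v. X v ! c) [0..<h])"
        using vw(1) by simp
      then have "X v ! c \<in> \<Union> (A // \<theta>')"
        using tr unfolding transversal_def by (meson subsetD)
      then obtain B where B: "B \<in> A // \<theta>'" "X v ! c \<in> B"
        by blast
      then have "\<exists>!i. i < h \<and> map (\<lambda>v. X v ! c) [0..<h] ! i \<in> B"
        using tr by (auto simp: transversal_def)
      moreover have "map (\<lambda>v. X v ! c) [0..<h] ! v \<in> B" "map (\<lambda>v. X v ! c) [0..<h] ! w \<in> B"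
        using B vw by auto
      ultimately show False
        using vw by blast
    qed
    ultimately show ?thesis
      by (simp add: regular_relation_def)
  qed
  then have "rs \<in> nlists n (regular_relation A h T)"
    by (auto simp: rs_def intro!: nlistsI)
  then have "map (\<lambda>j. F (map (\<lambda>r. r ! j) rs)) [0..<h] \<in> regular_relation A h T"
    using pres by (simp add: preserves_def)
  moreover have "map (\<lambda>r. r ! j) rs = X j" if "j < h" for j
    using X[OF that] that by (auto simp: rs_def intro!: nth_equalityI)
  then have "map (\<lambda>j. F (map (\<lambda>r. r ! j) rs)) [0..<h] = map (\<lambda>j. F (X j)) [0..<h]"
    by simp
  ultimately have "\<not> transversal (map (\<lambda>j. F (X j)) [0..<h]) (A // \<theta>)"
    using \<theta> by (simp add: regular_relation_def)
  moreover have "transversal (map (\<lambda>j. F (X j)) [0..<h]) (A // \<theta>)"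
    unfolding transversal_def
  proof (intro conjI ballI)
    show "set (map (\<lambda>j. F (X j)) [0..<h]) \<subseteq> \<Union> (A // \<theta>)"
      using Union_quotient[OF equiv[OF \<theta>]] F X by (auto dest: PiE_mem)
    fix B assume B: "B \<in> A // \<theta>"
    then obtain a where a: "a \<in> A" "B = \<theta> `` {a}"
      by (auto elim: quotientE)
    obtain v where v: "v < h" "(a, b v) \<in> \<theta>"
      using base_covers[OF \<theta> a(1)] by blast
    have sym: "sym \<theta>" and trans: "trans \<theta>"
      using equiv[OF \<theta>] by (auto elim: equivE)
    have "F (X j) \<in> B \<longleftrightarrow> j = v" if "j < h" for j
      using a(2) v val[OF that] base_separated[OF \<theta> that v(1)] sym trans
      by (meson Image_singleton_iff symE transE)
    then show "\<exists>!i. i < length (map (\<lambda>j. F (X j)) [0..<h]) \<and> map (\<lambda>j. F (X j)) [0..<h] ! i \<in> B"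
      using v(1) by (intro ex1I[of _ v]) auto
  qed
  ultimately show False
    by contradiction
qed

abbreviation point :: "nat \<Rightarrow> nat \<Rightarrow> nat \<Rightarrow> 'a list" where
  "point n d u \<equiv> (replicate n (b 0))[d := b u]"

lemma replicate_in: "v < h \<Longrightarrow> replicate n (b v) \<in> nlists n A"
  using base_in by (auto intro!: nlistsI)

lemma point_in: "u < h \<Longrightarrow> point n d u \<in> nlists n A"
  using base_in three_le by (intro nlistsI) (auto dest!: subsetD[OF set_update_subset_insert])

text \<open>If the value lay in a third block, that of \<open>b w\<close>, take the matrix of
  constant rows, replace row \<open>w\<close> by the point and apply
  \<open>not_preserving\<close>.\<close>

lemma point_value:
  assumes F: "F \<in> nlists n A \<rightarrow>\<^sub>E A" and pres: "preserves n F h (regular_relation A h T)"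
    and \<theta>: "\<theta> \<in> T" and diag: "\<And>v. v < h \<Longrightarrow> (F (replicate n (b v)), b v) \<in> \<theta>"
    and "u < h"
  shows "(F (point n d u), b 0) \<in> \<theta> \<or> (F (point n d u), b u) \<in> \<theta>"
proof (rule ccontr)
  assume no: "\<not> ?thesis"
  have "F (point n d u) \<in> A"
    using F point_in[OF \<open>u < h\<close>] by (rule PiE_mem)
  then obtain w where w: "w < h" "(F (point n d u), b w) \<in> \<theta>"
    using base_covers[OF \<theta>] by blast
  then have "w \<noteq> 0" "w \<noteq> u"
    using no by metis+
  define X where "X = (\<lambda>v. replicate n (b v))(w := point n d u)"
  show False
  proof (rule not_preserving[OF F pres \<theta>, of X])
    show "X v \<in> nlists n A" if "v < h" for v
      using that replicate_in point_in \<open>u < h\<close> by (auto simp: X_def)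
    show "(F (X v), b v) \<in> \<theta>" if "v < h" for v
      using that diag w by (auto simp: X_def)
    fix c assume "c < n"
    \<comment> \<open>Row \<open>w\<close> agrees with the constant row \<open>u\<close> in column
      \<open>d\<close> and with the constant row 0 elsewhere.\<close>
    then have "X (if c = d then u else 0) ! c = X w ! c"
      using \<open>w \<noteq> 0\<close> \<open>w \<noteq> u\<close> by (auto simp: X_def nth_list_update)
    then show "\<exists>v<h. \<exists>w<h. v \<noteq> w \<and> X v ! c = X w ! c"
      using \<open>w \<noteq> 0\<close> \<open>w \<noteq> u\<close> w(1) \<open>u < h\<close> by (metis gr0I not_less0)
  qed
qed

text \<open>Put \<open>b 2\<close> at \<open>d'\<close>. Sensitivity at another position
  \<open>d\<close> keeps the value of \<open>F\<close> out of the block of \<open>b 2\<close>, so by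
  \<open>point_value\<close> it stays in the block of \<open>b 0\<close>; sensitivity at
  \<open>d'\<close> itself excludes that.\<close>

lemma sensitive_position_unique:
  assumes F: "F \<in> nlists n A \<rightarrow>\<^sub>E A" and pres: "preserves n F h (regular_relation A h T)"
    and \<theta>: "\<theta> \<in> T" and diag: "\<And>v. v < h \<Longrightarrow> (F (replicate n (b v)), b v) \<in> \<theta>"
    and d: "(F (point n d 1), b 0) \<notin> \<theta>" and d': "(F (point n d' 1), b 0) \<notin> \<theta>"
  shows "d = d'"
proof (rule ccontr)
  assume "d \<noteq> d'"
  have lt: "0 < h" "1 < h" "2 < h"
    using three_le by auto
  have one: "(F (point n d 1), b 1) \<in> \<theta>" "(F (point n d' 1), b 1) \<in> \<theta>"
    using point_value[OF F pres \<theta> diag lt(2)] d d' by blast+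
  have no_two: "(F (point n d' 2), b 2) \<notin> \<theta>"
  proof
    assume two: "(F (point n d' 2), b 2) \<in> \<theta>"
    \<comment> \<open>The constant row 0 agrees with row 2 in column \<open>d\<close>, as
      \<open>d\<close> differs from \<open>d'\<close>, and with row 1 in every other column.\<close>
    define X where "X = (\<lambda>v. replicate n (b v))(1 := point n d 1, 2 := point n d' 2)"
    show False
    proof (rule not_preserving[OF F pres \<theta>, of X])
      show "X v \<in> nlists n A" if "v < h" for v
        using that replicate_in point_in lt by (auto simp: X_def)
      show "(F (X v), b v) \<in> \<theta>" if "v < h" for v
        using that diag one two by (auto simp: X_def)
      fix c assume "c < n"
      then have "X 0 ! c = X (if c = d then 2 else 1) ! c"
        using \<open>d \<noteq> d'\<close> by (auto simp: X_def nth_list_update)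
      then show "\<exists>v<h. \<exists>w<h. v \<noteq> w \<and> X v ! c = X w ! c"
        using lt by (metis zero_neq_numeral zero_neq_one)
    qed
  qed
  then have zero: "(F (point n d' 2), b 0) \<in> \<theta>"
    using point_value[OF F pres \<theta> diag lt(3)] by blast
  \<comment> \<open>Row 0 now agrees with the constant row 2 in column \<open>d'\<close> and with
    row 1 in every other column.\<close>
  define X where "X = (\<lambda>v. replicate n (b v))(1 := point n d' 1, 0 := point n d' 2)"
  show False
  proof (rule not_preserving[OF F pres \<theta>, of X])
    show "X v \<in> nlists n A" if "v < h" for v
      using that replicate_in point_in lt by (auto simp: X_def)
    show "(F (X v), b v) \<in> \<theta>" if "v < h" for v
      using that diag one zero by (auto simp: X_def)
    fix c assume "c < n"
    then have "X 0 ! c = X (if c = d' then 2 else 1) ! c"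
      by (auto simp: X_def nth_list_update)
    then show "\<exists>v<h. \<exists>w<h. v \<noteq> w \<and> X v ! c = X w ! c"
      using lt by (metis zero_neq_numeral zero_neq_one)
  qed
qed

section \<open>The diagonal operations and their comparison\<close>

definition diagonal_op :: "'a \<Rightarrow> 'a rel \<Rightarrow> nat \<Rightarrow> 'a list \<Rightarrow> 'a" where
  "diagonal_op z \<theta> n = (\<lambda>xs\<in>nlists n A.
     if \<exists>v<h. \<forall>x\<in>set xs. (x, b v) \<in> \<theta> then b (SOME v. v < h \<and> (\<forall>x\<in>set xs. (x, b v) \<in> \<theta>)) else z)"

text \<open>Since \<open>1 \<le> n\<close>, the tuple has an entry, which determines
  \<open>v\<close> by \<open>base_separated\<close>; so the choice in the definition is forced. The
  default \<open>z\<close> is none of the \<open>b v\<close>.\<close>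

lemma diagonal_op_eq_iff:
  assumes \<theta>: "\<theta> \<in> T" and z: "z \<notin> b ` {..<h}" and "1 \<le> n" and xs: "xs \<in> nlists n A" and "v < h"
  shows "diagonal_op z \<theta> n xs = b v \<longleftrightarrow> (\<forall>x\<in>set xs. (x, b v) \<in> \<theta>)"
proof -
  have sym: "sym \<theta>" and trans: "trans \<theta>"
    using equiv[OF \<theta>] by (auto elim: equivE)
  have "xs \<noteq> []"
    using \<open>1 \<le> n\<close> nlistsE_length[OF xs] by auto
  have uniq: "w = w'" if "w < h" "w' < h" "\<forall>x\<in>set xs. (x, b w) \<in> \<theta>" "\<forall>x\<in>set xs. (x, b w') \<in> \<theta>" for w w'
    using that base_separated[OF \<theta>] sym trans \<open>xs \<noteq> []\<close> by (meson hd_in_set symE transE)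
  have inj: "w = w'" if "w < h" "w' < h" "b w = b w'" for w w'
    using that base_separated[OF \<theta>] base_in equiv[OF \<theta>] by (metis equiv_class_self Image_singleton_iff)
  show ?thesis
  proof (cases "\<exists>w<h. \<forall>x\<in>set xs. (x, b w) \<in> \<theta>")
    case True
    then obtain w where w: "w < h" "\<forall>x\<in>set xs. (x, b w) \<in> \<theta>"
      by blast
    then have "(SOME w. w < h \<and> (\<forall>x\<in>set xs. (x, b w) \<in> \<theta>)) = w"
      by (intro some_equality) (use uniq in blast)+
    then have "diagonal_op z \<theta> n xs = b w"
      using True xs by (simp add: diagonal_op_def)
    then show ?thesis
      using w uniq inj \<open>v < h\<close> by metis
  next
    case False
    then show ?thesis
      using xs z \<open>v < h\<close> by (auto simp: diagonal_op_def)
  qed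
qed

lemma diagonal_op_in_operations:
  assumes "1 \<le> n" "z \<in> A"
  shows "(n, diagonal_op z \<theta> n) \<in> operations A"
proof -
  have "b (SOME v. v < h \<and> (\<forall>x\<in>set xs. (x, b v) \<in> \<theta>)) \<in> A" if "\<exists>v<h. \<forall>x\<in>set xs. (x, b v) \<in> \<theta>" for xs
    using someI_ex[OF that] base_in by blast
  then show ?thesis
    using assms by (auto simp: operations_def diagonal_op_def)
qed

lemma diagonal_op_le_imp_le:
  assumes \<theta>: "\<theta> \<in> T" and z: "z \<notin> b ` {..<h}" and n: "1 \<le> n" and m: "1 \<le> m"
    and le: "clone_le A (Pol A h (regular_relation A h T)) (n, diagonal_op z \<theta> n) (m, diagonal_op z \<theta> m)"
  shows "n \<le> m"
proof -
  obtain hs where hs: "hs \<in> nlists m (nary_part (Pol A h (regular_relation A h T)) n)"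
    and comp: "diagonal_op z \<theta> n = compose_op A n (diagonal_op z \<theta> m) hs"
    using le by (auto simp: clone_le_def)
  have F: "F \<in> nlists n A \<rightarrow>\<^sub>E A" "preserves n F h (regular_relation A h T)" if "F \<in> set hs" for F
    using that nlistsE_set[OF hs] by (auto simp: nary_part_def Pol_def operations_def)
  have iff: "(\<forall>x\<in>set xs. (x, b v) \<in> \<theta>) \<longleftrightarrow> (\<forall>F\<in>set hs. (F xs, b v) \<in> \<theta>)"
    if xs: "xs \<in> nlists n A" and v: "v < h" for xs v
  proof -
    have img: "map (\<lambda>F. F xs) hs \<in> nlists m A"
      using F xs nlistsE_length[OF hs] by (intro nlistsI) (auto dest: PiE_mem)
    have "diagonal_op z \<theta> n xs = diagonal_op z \<theta> m (map (\<lambda>F. F xs) hs)"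
      using xs by (simp add: comp compose_op_def)
    then show ?thesis
      using diagonal_op_eq_iff[OF \<theta> z n xs v] diagonal_op_eq_iff[OF \<theta> z m img v] by simp
  qed
  have lt: "0 < h" "1 < h"
    using three_le by auto
  \<comment> \<open>For a constant tuple of \<open>b v\<close> the left side of \<open>iff\<close>
    is reflexivity of \<theta>.\<close>
  have diag: "(F (replicate n (b v)), b v) \<in> \<theta>" if "F \<in> set hs" "v < h" for F v
    using iff[OF replicate_in] that base_in equiv[OF \<theta>]
    by (metis equiv_class_self Image_singleton_iff in_set_replicate)
  \<comment> \<open>The entry \<open>b 1\<close> at \<open>d\<close> violates the left side of
    \<open>iff\<close> for \<open>b 0\<close>, so some inner operation is sensitive at
    \<open>d\<close>; \<open>G\<close> picks one for each position.\<close>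
  have "\<exists>F\<in>set hs. (F (point n d 1), b 0) \<notin> \<theta>" if "d < n" for d
  proof -
    have "b 1 \<in> set (point n d 1)"
      using that by (simp add: set_update_memI)
    moreover have "(b 1, b 0) \<notin> \<theta>"
      using base_separated[OF \<theta> lt(2,1)] by auto
    ultimately show ?thesis
      using iff[OF point_in[OF lt(2)] lt(1)] by blast
  qed
  then obtain G where G: "\<And>d. d < n \<Longrightarrow> G d \<in> set hs \<and> (G d (point n d 1), b 0) \<notin> \<theta>"
    by metis
  have "inj_on G {..<n}"
  proof (rule inj_onI)
    fix d d' assume "d \<in> {..<n}" "d' \<in> {..<n}" and eq: "G d = G d'"
    then have Gd: "G d \<in> set hs" "(G d (point n d 1), b 0) \<notin> \<theta>" "(G d (point n d' 1), b 0) \<notin> \<theta>"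
      using G[of d] G[of d'] by auto
    show "d = d'"
      using sensitive_position_unique[OF F[OF Gd(1)] \<theta> diag[OF Gd(1)] Gd(2,3)] .
  qed
  then have "card {..<n} \<le> card (set hs)"
    using G by (intro card_inj_on_le) auto
  also have "\<dots> \<le> m"
    using card_length[of hs] nlistsE_length[OF hs] by simp
  finally show ?thesis
    by simp
qed

end

theorem theorem6p3:
  fixes A :: "'a set" and k h :: nat and T :: "'a rel set"
  assumes "finite A" and "card A = k" and "k \<ge> 3"
    and "regular_family A h T" and "h < k"
  shows "Pol A h (regular_relation A h T) \<notin> finite_equiv_clones A"
proof
  let ?C = "Pol A h (regular_relation A h T)"
  assume "?C \<in> finite_equiv_clones A"
  then have "clone A ?C" and fin: "finite (operations A // clone_equiv A ?C)"
    by (auto simp: finite_equiv_clones_def)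
  obtain b where "separated_family A h T b"
    using regular_family_separated[OF assms(4)] .
  then interpret separated_family A h T b .
  obtain \<theta> where \<theta>: "\<theta> \<in> T"
    using assms(4) by (auto simp: regular_family_def)
  \<comment> \<open>Here \<open>h < k\<close> enters: the representatives do not exhaust
    \<open>A\<close>.\<close>
  have "card (b ` {..<h}) < card A"
    using card_image_le[of "{..<h}" b] assms by simp
  then obtain z where z: "z \<in> A" "z \<notin> b ` {..<h}"
    by (metis card_mono finite_imageI finite_lessThan not_less subsetI)
  define cls where "cls = (\<lambda>n. clone_equiv A ?C `` {(n, diagonal_op z \<theta> n)})"
  have "inj_on cls {1..}"
  proof (rule inj_onI)
    fix n m :: nat assume nm: "n \<in> {1..}" "m \<in> {1..}" "cls n = cls m"
    then have "((n, diagonal_op z \<theta> n), (m, diagonal_op z \<theta> m)) \<in> clone_equiv A ?C"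
      using eq_equiv_class[OF _ equiv_clone_equiv[OF \<open>clone A ?C\<close>]] diagonal_op_in_operations z(1)
      by (auto simp: cls_def)
    then show "n = m"
      using diagonal_op_le_imp_le[OF \<theta> z(2)] nm by (auto simp: clone_equiv_def intro: antisym)
  qed
  moreover have "cls ` {1..} \<subseteq> operations A // clone_equiv A ?C"
    using diagonal_op_in_operations z(1) by (auto simp: cls_def intro: quotientI)
  ultimately have "finite {1::nat..}"
    using fin by (metis finite_imageD finite_subset)
  then show False
    using infinite_Ici by blast
qed

end
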